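(* For a positive integer $n$, let $M(n)$ be the largest size of a set of permutations of $[n]=\{1,\dots,n\}$ such that any two distinct permutations in the set are locally disjoint. Then $$\frac{n!}{5^n}\le M(n)\le \frac{n!}{6^{\lfloor n/3\rfloor}}.$$
   Context: A permutation of $[n]$ is a bijection $[n]\to[n]$; for a permutation $\sigma$ and $a\in[n]$, $\sigma^{-1}(a)$ is the position of $a$ when $\sigma$ is viewed as the linear order $\sigma(1),\dots,\sigma(n)$. Two permutations $\sigma,\tau$ of $[n]$ are called locally disjoint if there exist two distinct elements $a,b\in[n]$ such that $\sigma^{-1}(a)<\sigma^{-1}(b)<\tau^{-1}(a)<\tau^{-1}(b)$ or $\tau^{-1}(a)<\tau^{-1}(b)<\sigma^{-1}(a)<\sigma^{-1}(b)$. *)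

theory Defs
  imports Complex_Main "HOL-Combinatorics.Permutations"
begin

text \<open>Permutations of \<open>{1..n}\<close> are functions \<open>\<sigma>\<close> with \<open>\<sigma> permutes {1..n}\<close>, i.e. extended by
  the identity outside \<open>{1..n}\<close>; hence \<open>inv \<sigma> a\<close> is the position of \<open>a\<close> for \<open>a \<in> {1..n}\<close>, and
  equality of functions is equality of permutations.\<close>

definition locally_disjoint :: "nat \<Rightarrow> (nat \<Rightarrow> nat) \<Rightarrow> (nat \<Rightarrow> nat) \<Rightarrow> bool" where
  "locally_disjoint n \<sigma> \<tau> \<longleftrightarrow>
     (\<exists>a\<in>{1..n}. \<exists>b\<in>{1..n}. a \<noteq> b \<and>
        ((inv \<sigma> a < inv \<sigma> b \<and> inv \<sigma> b < inv \<tau> a \<and> inv \<tau> a < inv \<tau> b) \<or>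
         (inv \<tau> a < inv \<tau> b \<and> inv \<tau> b < inv \<sigma> a \<and> inv \<sigma> a < inv \<sigma> b)))"

definition locally_disjoint_families :: "nat \<Rightarrow> (nat \<Rightarrow> nat) set set" where
  "locally_disjoint_families n =
     {S. S \<subseteq> {\<sigma>. \<sigma> permutes {1..n}} \<and> pairwise (locally_disjoint n) S}"

definition max_locally_disjoint :: "nat \<Rightarrow> nat" where
  "max_locally_disjoint n = Max (card ` locally_disjoint_families n)"

text \<open>The maximum is taken over a finite nonempty set of cardinalities of finite sets.\<close>

lemma finite_locally_disjoint_families: "finite (locally_disjoint_families n)"
  by (rule finite_subset[of _ "Pow {\<sigma>. \<sigma> permutes {1..n}}"])
     (auto simp: locally_disjoint_families_def finite_permutations)

lemma locally_disjoint_families_nonempty: "locally_disjoint_families n \<noteq> {}"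
  by (auto simp: locally_disjoint_families_def intro!: exI[of _ "{}"])

lemma finite_locally_disjoint_family:
  "S \<in> locally_disjoint_families n \<Longrightarrow> finite S"
  unfolding locally_disjoint_families_def
  using finite_subset[OF _ finite_permutations[of "{1..n}"]] by blast

end

theory Submission
  imports Defs "HOL-Library.FuncSet"
begin

text \<open>Upper bound: right multiplication by permutations that preserve the blocks
  \<open>{1,2,3}, {4,5,6}, \<dots>\<close> of positions never produces a locally disjoint pair, since the four
  positions involved would be distinct and lie in one block. Hence a family meets every coset of
  this group of order at least \<open>6 ^ (n div 3)\<close> at most once.

  Lower bound: by maximality every permutation fails to be locally disjoint from some member of a
  largest family, so it suffices that at most \<open>5 ^ n\<close> permutations are not locally disjoint from a
  given \<open>\<sigma>\<close>. For \<open>\<tau>\<close> put \<open>\<pi> = inv \<tau> \<circ> \<sigma>\<close>. Failure of local disjointness says that in the arc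
  diagram of \<open>\<pi>\<close> neither the arcs \<open>i < \<pi> i\<close> nor the arcs \<open>i > \<pi> i\<close> cross. Such a diagram is
  recovered from the signs of \<open>\<pi> i - i\<close> and \<open>inv \<pi> i - i\<close> alone (every arc closes the most
  recently opened one), and these give only five possibilities per point: if one sign vanishes,
  so does the other.\<close>

section \<open>Arc diagrams without crossings\<close>

definition noncrossing :: "(nat \<Rightarrow> nat) \<Rightarrow> bool" where
  "noncrossing f \<longleftrightarrow> (\<nexists>i j. i < j \<and> j < f i \<and> f i < f j)"

lemma locally_disjoint_sym: "locally_disjoint n \<sigma> \<tau> \<Longrightarrow> locally_disjoint n \<tau> \<sigma>"
  unfolding locally_disjoint_def by blast

lemma locally_disjoint_irrefl: "\<not> locally_disjoint n \<sigma> \<sigma>"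
  unfolding locally_disjoint_def by auto

text \<open>At a crossing, the elements \<open>\<sigma> i\<close> and \<open>\<sigma> j\<close> have
  positions \<open>i\<close>, \<open>j\<close> under \<open>\<sigma>\<close>, and under
  \<open>\<tau>\<close> their positions are the right ends of the two arcs: they witness local
  disjointness.\<close>

lemma noncrossing_if_not_locally_disjoint:
  assumes \<sigma>: "\<sigma> permutes {1..n}" and \<tau>: "\<tau> permutes {1..n}"
    and nld: "\<not> locally_disjoint n \<sigma> \<tau>"
  shows "noncrossing (inv \<tau> \<circ> \<sigma>)"
  unfolding noncrossing_def
proof clarify
  fix i j
  assume ij: "i < j" "j < (inv \<tau> \<circ> \<sigma>) i" "(inv \<tau> \<circ> \<sigma>) i < (inv \<tau> \<circ> \<sigma>) j"
  have perm: "(inv \<tau> \<circ> \<sigma>) permutes {1..n}"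
    by (rule permutes_compose[OF \<sigma> permutes_inv[OF \<tau>]])
  \<comment> \<open>Points outside \<open>{1..n}\<close> are fixed, but \<open>ij\<close> shows that
    \<open>i\<close> and \<open>j\<close> move.\<close>
  have "i \<in> {1..n}" "j \<in> {1..n}"
    using permutes_not_in[OF perm, of i] permutes_not_in[OF perm, of j] ij by fastforce+
  then have "\<sigma> i \<in> {1..n}" "\<sigma> j \<in> {1..n}"
    by (simp_all only: permutes_in_image[OF \<sigma>])
  moreover have "inv \<sigma> (\<sigma> i) = i" "inv \<sigma> (\<sigma> j) = j"
    using permutes_inverses[OF \<sigma>] by auto
  moreover have "\<sigma> i \<noteq> \<sigma> j" using ij by auto
  ultimately have "locally_disjoint n \<sigma> \<tau>"
    unfolding locally_disjoint_def using ij
    by (intro bexI[of _ "\<sigma> i"] bexI[of _ "\<sigma> j"]) auto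
  with nld show False by simp
qed

text \<open>Strong induction on the right end \<open>j\<close> of the arc. If the left ends differ, say
  \<open>inv f j < i\<close> with \<open>i = inv g j\<close>, then \<open>i\<close> also opens an arc of \<open>f\<close>; it cannot end before \<open>j\<close> by
  induction, and if it ends after \<open>j\<close> it crosses the arc from \<open>inv f j\<close> to \<open>j\<close>.\<close>
lemma noncrossing_inv_eq:
  assumes "bij f" "bij g" "noncrossing f" "noncrossing g"
    and opens: "\<And>i. i < f i \<longleftrightarrow> i < g i"
    and closes: "\<And>j. inv f j < j \<longleftrightarrow> inv g j < j"
    and "inv f j < j"
  shows "inv g j = inv f j"
proof -
  \<comment> \<open>Quantified over \<open>f\<close> and \<open>g\<close> so that exchanging them
    excludes the other order as well.\<close>
  have "\<not> inv f j < inv g j"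
    if "bij f" "bij g" "noncrossing f" "\<And>i. i < f i \<longleftrightarrow> i < g i"
      and j: "inv g j < j" and IH: "\<And>k. k < j \<Longrightarrow> inv f k < k \<Longrightarrow> inv g k = inv f k"
    for f g :: "nat \<Rightarrow> nat" and j
  proof
    assume less: "inv f j < inv g j"
    define i where "i = inv g j"
    have gi: "g i = j" and fj: "f (inv f j) = j"
      using that by (simp_all add: i_def bij_is_surj surj_f_inv_f)
    have inv_fi: "inv f (f i) = i" and "inv g (g i) = i"
      using that by (simp_all add: bij_is_inj inv_f_f)
    have i: "i < f i"
      using that(4) j gi by (simp add: i_def)
    consider "f i < j" | "f i = j" | "j < f i" by linarith
    then show False
    proof cases
      case 1
      then have "inv g (f i) = i"
        using IH[of "f i"] i inv_fi by simp
      then have "g i = f i"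
        using that(2) by (metis bij_is_surj surj_f_inv_f)
      with 1 gi show False by simp
    next
      case 2
      with less inv_fi show False by (simp add: i_def)
    next
      case 3
      then have "inv f j < i" "i < f (inv f j)" "f (inv f j) < f i"
        using less j fj by (simp_all add: i_def)
      with that(3) show False
        unfolding noncrossing_def by blast
    qed
  qed
  note key = this
  show ?thesis using \<open>inv f j < j\<close>
  proof (induction j rule: less_induct)
    case (less j)
    have gj: "inv g j < j" using less.prems closes by simp
    have IH': "inv f k = inv g k" if "k < j" "inv g k < k" for k
      by (rule less.IH[symmetric, OF that(1) iffD2[OF closes that(2)]])
    have "\<not> inv f j < inv g j"
      by (rule key[OF assms(1-3) opens gj less.IH])
    moreover have "\<not> inv g j < inv f j"
      by (rule key[OF assms(2,1,4) opens[symmetric] less.prems IH'])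
    ultimately show ?case by simp
  qed
qed

section \<open>Encoding by five types per point\<close>

definition point_type :: "(nat \<Rightarrow> nat) \<Rightarrow> nat \<Rightarrow> int \<times> int" where
  "point_type f i = (sgn (int (f i) - int i), sgn (int (inv f i) - int i))"

text \<open>Besides fixed points: \<open>(1, 1)\<close> opens an ascending and a descending arc,
  \<open>(-1, -1)\<close> closes one of each, \<open>(1, -1)\<close> closes one ascending arc and
  opens another, \<open>(-1, 1)\<close> does so for descending arcs.\<close>

definition point_types :: "(int \<times> int) set" where
  "point_types = {(0, 0), (1, 1), (1, -1), (-1, 1), (-1, -1)}"

lemma card_point_types: "card point_types = 5"
  by (simp add: point_types_def)

lemma point_type_in_point_types:
  assumes "bij f"
  shows "point_type f i \<in> point_types"
proof -
  have "f i = i \<longleftrightarrow> inv f i = i"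
    using assms by (metis bij_inv_eq_iff)
  then show ?thesis
    by (auto simp: point_type_def point_types_def sgn_if)
qed

lemma point_type_eqD:
  assumes "point_type f i = point_type g i"
  shows "i < f i \<longleftrightarrow> i < g i" "f i < i \<longleftrightarrow> g i < i"
    "i < inv f i \<longleftrightarrow> i < inv g i" "inv f i < i \<longleftrightarrow> inv g i < i"
  using assms by (auto simp: point_type_def sgn_if split: if_splits)

text \<open>Descending arcs of \<open>f\<close> are the ascending arcs of \<open>inv f\<close>, so
  recovering ascending arcs for both functions determines \<open>f\<close> off its fixed
  points.\<close>

lemma noncrossing_eqI:
  assumes f: "bij f" "noncrossing f" "noncrossing (inv f)"
    and g: "bij g" "noncrossing g" "noncrossing (inv g)"
    and types: "\<And>i. point_type f i = point_type g i"
  shows "f = g"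
proof
  fix i
  note types' = point_type_eqD[OF types]
  have inv_inv: "inv (inv f) = f" "inv (inv g) = g"
    using f g by (simp_all add: inv_inv_eq)
  consider "i < f i" | "f i = i" | "f i < i" by linarith
  then show "f i = g i"
  proof cases
    case 1
    have "inv f (f i) = i" using f(1) by (simp add: bij_is_inj inv_f_f)
    then have "inv g (f i) = i"
      using noncrossing_inv_eq[OF f(1) g(1) f(2) g(2) types'(1,4), of "f i"] 1 by simp
    then show ?thesis using g(1) by (metis bij_inv_eq_iff)
  next
    case 2
    then show ?thesis using types'(1,2)[of i] by linarith
  next
    case 3
    \<comment> \<open>Here \<open>f i\<close> is the left end of the arc of \<open>inv f\<close>
      that ends at \<open>i\<close>.\<close>
    then have "inv (inv f) i < i" by (simp add: inv_inv)
    then have "inv (inv g) i = inv (inv f) i"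
      by (rule noncrossing_inv_eq[rotated -1])
        (simp_all only: inv_inv f g bij_imp_bij_inv types')
    then show ?thesis by (simp add: inv_inv)
  qed
qed

section \<open>Lower bound\<close>

lemma card_not_locally_disjoint_le:
  assumes \<sigma>: "\<sigma> permutes {1..n}"
  shows "card {\<tau>. \<tau> permutes {1..n} \<and> \<not> locally_disjoint n \<sigma> \<tau>} \<le> 5 ^ n"
proof -
  define N where "N = {\<tau>. \<tau> permutes {1..n} \<and> \<not> locally_disjoint n \<sigma> \<tau>}"
  define \<pi> where "\<pi> \<tau> = inv \<tau> \<circ> \<sigma>" for \<tau> :: "nat \<Rightarrow> nat"
  \<comment> \<open>The restriction loses nothing, since points outside \<open>{1..n}\<close> have
    type \<open>(0, 0)\<close>.\<close>
  define F where "F \<tau> = restrict (point_type (\<pi> \<tau>)) {1..n}" for \<tau>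
  have perm: "\<pi> \<tau> permutes {1..n}" if "\<tau> \<in> N" for \<tau>
    unfolding \<pi>_def by (rule permutes_compose[OF \<sigma> permutes_inv]) (use that in \<open>simp add: N_def\<close>)
  have inv_\<pi>: "inv (\<pi> \<tau>) = inv \<sigma> \<circ> \<tau>" if "\<tau> \<in> N" for \<tau>
  proof -
    have "bij \<sigma>" "bij \<tau>" using \<sigma> that by (auto simp: N_def permutes_bij)
    then show ?thesis unfolding \<pi>_def
      by (simp add: o_inv_distrib bij_imp_bij_inv inv_inv_eq)
  qed
  \<comment> \<open>The inverse has the same form with \<open>\<sigma>\<close> and
    \<open>\<tau>\<close> exchanged, so symmetry of local disjointness covers it.\<close>
  have nc: "noncrossing (\<pi> \<tau>)" "noncrossing (inv (\<pi> \<tau>))" if "\<tau> \<in> N" for \<tau>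
    using that noncrossing_if_not_locally_disjoint[of \<sigma> n \<tau>]
      noncrossing_if_not_locally_disjoint[of \<tau> n \<sigma>] \<sigma> locally_disjoint_sym[of n \<tau> \<sigma>]
    by (auto simp: inv_\<pi>[OF that]) (auto simp: N_def \<pi>_def)
  have "inj_on F N"
  proof (rule inj_onI)
    fix \<tau> \<upsilon> assume N: "\<tau> \<in> N" "\<upsilon> \<in> N" and F: "F \<tau> = F \<upsilon>"
    have "point_type (\<pi> \<tau>) i = point_type (\<pi> \<upsilon>) i" for i
    proof (cases "i \<in> {1..n}")
      case True
      then show ?thesis using fun_cong[OF F, of i] by (simp add: F_def)
    next
      case False
      have fixed: "\<pi> \<rho> i = i" "inv (\<pi> \<rho>) i = i" if "\<rho> \<in> N" for \<rho>
        using permutes_not_in[OF perm[OF that] False]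
          permutes_not_in[OF permutes_inv[OF perm[OF that]] False] .
      show ?thesis
        unfolding point_type_def by (simp only: fixed[OF N(1)] fixed[OF N(2)])
    qed
    then have "\<pi> \<tau> = \<pi> \<upsilon>"
      by (rule noncrossing_eqI[OF permutes_bij[OF perm[OF N(1)]] nc[OF N(1)]
            permutes_bij[OF perm[OF N(2)]] nc[OF N(2)]])
    then have "inv \<tau> = inv \<upsilon>"
      unfolding \<pi>_def using permutes_surj[OF \<sigma>] by (metis fun.map_comp surj_iff comp_id)
    moreover have "\<tau> permutes {1..n}" "\<upsilon> permutes {1..n}"
      using N by (simp_all add: N_def)
    ultimately show "\<tau> = \<upsilon>"
      by (metis permutes_inv_inv)
  qed
  moreover have "F ` N \<subseteq> PiE {1..n} (\<lambda>_. point_types)"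
    using perm by (auto simp: F_def intro!: point_type_in_point_types permutes_bij)
  moreover have "finite (PiE {1..n} (\<lambda>_. point_types))"
    by (auto intro!: finite_PiE simp: point_types_def)
  ultimately have "card N \<le> card (PiE {1..n} (\<lambda>_. point_types))"
    by (rule card_inj_on_le)
  then show ?thesis
    by (simp add: N_def card_PiE card_point_types)
qed

lemma fact_le_max_locally_disjoint: "fact n \<le> max_locally_disjoint n * 5 ^ n"
proof -
  let ?P = "{\<sigma>. \<sigma> permutes {1..n}}"
  let ?N = "\<lambda>\<sigma>. {\<tau>. \<tau> permutes {1..n} \<and> \<not> locally_disjoint n \<sigma> \<tau>}"
  have fin: "finite (card ` locally_disjoint_families n)"
    by (simp add: finite_locally_disjoint_families)
  then obtain S where S: "S \<in> locally_disjoint_families n" "card S = max_locally_disjoint n"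
    unfolding max_locally_disjoint_def
    using Max_in[OF fin] locally_disjoint_families_nonempty by (metis empty_is_image imageE)
  have finS: "finite S" using S(1) by (rule finite_locally_disjoint_family)
  have perm: "\<sigma> permutes {1..n}" if "\<sigma> \<in> S" for \<sigma>
    using S(1) that by (auto simp: locally_disjoint_families_def)
  have cover: "?P \<subseteq> (\<Union>\<sigma>\<in>S. ?N \<sigma>)"
  proof (rule subsetI, rule ccontr)
    fix \<tau> assume \<tau>: "\<tau> \<in> ?P" and "\<tau> \<notin> (\<Union>\<sigma>\<in>S. ?N \<sigma>)"
    then have ld: "locally_disjoint n \<sigma> \<tau>" if "\<sigma> \<in> S" for \<sigma>
      using that by auto
    then have "\<tau> \<notin> S" using locally_disjoint_irrefl by blast
    have "insert \<tau> S \<in> locally_disjoint_families n"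
      using S(1) \<tau> ld locally_disjoint_sym
      by (auto simp: locally_disjoint_families_def pairwise_insert)
    then have "card (insert \<tau> S) \<le> max_locally_disjoint n"
      unfolding max_locally_disjoint_def using fin by (intro Max_ge) auto
    then show False using \<open>\<tau> \<notin> S\<close> finS S(2) by simp
  qed
  have "fact n = card ?P"
    by (rule card_permutations[symmetric]) simp_all
  also have "\<dots> \<le> card (\<Union>\<sigma>\<in>S. ?N \<sigma>)"
    by (rule card_mono[OF _ cover])
      (auto intro!: finS intro: finite_subset[OF _ finite_permutations[of "{1..n}"]])
  also have "\<dots> \<le> (\<Sum>\<sigma>\<in>S. card (?N \<sigma>))"
    using finS by (rule card_UN_le)
  also have "\<dots> \<le> (\<Sum>\<sigma>\<in>S. 5 ^ n)"
    by (rule sum_mono) (rule card_not_locally_disjoint_le[OF perm])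
  finally show ?thesis by (simp add: S(2))
qed

section \<open>Upper bound\<close>

text \<open>The block of a position \<open>i \<ge> 1\<close> is \<open>(i + 2) div 3\<close>.\<close>
definition block_perms :: "nat \<Rightarrow> (nat \<Rightarrow> nat) set" where
  "block_perms k = {h. h permutes {1..3 * k} \<and> (\<forall>i. (h i + 2) div 3 = (i + 2) div 3)}"

lemma card_block_perms_ge: "6 ^ k \<le> card (block_perms k)"
proof (induction k)
  case 0
  have "block_perms 0 = {id}" by (auto simp: block_perms_def permutes_empty)
  then show ?case by simp
next
  case (Suc k)
  define B where "B = {3 * k + 1..3 * k + 3}"
  let ?G = "{g. g permutes B}"
  have fin: "finite (block_perms k)" for k
    unfolding block_perms_def
    by (rule finite_subset[OF _ finite_permutations[of "{1..3 * k}"]]) auto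
  have disj: "{1..3 * k} \<inter> B = {}" by (auto simp: B_def)
  \<comment> \<open>On the new block \<open>B\<close> the factor \<open>h\<close> is the identity,
    so the product reveals \<open>g\<close>, and cancelling \<open>g\<close> reveals
    \<open>h\<close>.\<close>
  have "inj_on (\<lambda>(h, g). h \<circ> g) (block_perms k \<times> ?G)"
  proof (rule inj_onI, clarify)
    fix h g h' g'
    assume h: "h \<in> block_perms k" "h' \<in> block_perms k"
      and g: "g permutes B" "g' permutes B" and eq: "h \<circ> g = h' \<circ> g'"
    have hp: "h permutes {1..3 * k}" "h' permutes {1..3 * k}"
      using h by (auto simp: block_perms_def)
    have "g i = g' i" for i
    proof (cases "i \<in> B")
      case True
      then have "g i \<in> B" "g' i \<in> B"
        using g by (simp_all only: permutes_in_image)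
      then have "h (g i) = g i" "h' (g' i) = g' i"
        using disj hp by (auto intro!: permutes_not_in)
      then show ?thesis using fun_cong[OF eq, of i] by simp
    next
      case False
      then show ?thesis using g by (simp add: permutes_not_in)
    qed
    then have "g = g'" by auto
    then have "h = h'"
      using eq permutes_surj[OF g(1)] by (metis fun.map_comp surj_iff comp_id)
    with \<open>g = g'\<close> show "h = h' \<and> g = g'" by simp
  qed
  moreover have "(\<lambda>(h, g). h \<circ> g) ` (block_perms k \<times> ?G) \<subseteq> block_perms (Suc k)"
  proof clarify
    fix h g assume h: "h \<in> block_perms k" and g: "g permutes B"
    have "h permutes {1..3 * Suc k}" "g permutes {1..3 * Suc k}"
      using h g by (auto simp: block_perms_def B_def elim!: permutes_subset)
    then have "h \<circ> g permutes {1..3 * Suc k}"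
      by (intro permutes_compose)
    moreover have "(g i + 2) div 3 = (i + 2) div 3" for i
    proof (cases "i \<in> B")
      case True
      then have "g i \<in> B" using g by (simp only: permutes_in_image)
      have "(j + 2) div 3 = k + 1" if "j \<in> B" for j
        using that by (auto simp: B_def)
      with True \<open>g i \<in> B\<close> show ?thesis by simp
    next
      case False
      then show ?thesis using g by (simp add: permutes_not_in)
    qed
    ultimately show "h \<circ> g \<in> block_perms (Suc k)"
      using h by (auto simp: block_perms_def)
  qed
  ultimately have "card (block_perms k \<times> ?G) \<le> card (block_perms (Suc k))"
    by (rule card_inj_on_le[OF _ _ fin])
  moreover have "card ?G = 6"
    using card_permutations[of B 3] by (simp add: B_def fact_numeral)
  ultimately show ?case
    using Suc.IH by (simp add: card_cartesian_product)
qed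

text \<open>If \<open>p < q < r < s\<close> with \<open>p\<close>, \<open>r\<close> in one block and
  \<open>q\<close>, \<open>s\<close> in one block, then \<open>q\<close> lies in the block of
  \<open>p\<close> and \<open>r\<close>, hence so does \<open>s\<close>; but a block has at most
  three elements.\<close>

lemma not_locally_disjoint_same_blocks:
  assumes blocks: "\<And>a. (inv \<sigma> a + 2) div 3 = (inv \<tau> a + 2) div 3"
  shows "\<not> locally_disjoint n \<sigma> \<tau>"
proof -
  have "\<not> (p < q \<and> q < r \<and> r < s)"
    if "(p + 2) div 3 = (r + 2) div 3" "(q + 2) div 3 = (s + 2) div 3" for p q r s :: nat
  proof
    assume "p < q \<and> q < r \<and> r < s"
    moreover from this have "(p + 2) div 3 \<le> (q + 2) div 3" "(q + 2) div 3 \<le> (r + 2) div 3"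
      by (auto intro!: div_le_mono)
    ultimately show False using that by linarith
  qed
  then show ?thesis
    unfolding locally_disjoint_def using blocks by metis
qed

lemma card_locally_disjoint_family_le:
  assumes S: "S \<in> locally_disjoint_families n"
  shows "card S * 6 ^ (n div 3) \<le> fact n"
proof -
  \<comment> \<open>Only full blocks are permuted; the at most two remaining positions stay
    fixed.\<close>
  let ?H = "block_perms (n div 3)"
  let ?P = "{\<sigma>. \<sigma> permutes {1..n}}"
  have SP: "\<sigma> permutes {1..n}" if "\<sigma> \<in> S" for \<sigma>
    using S that by (auto simp: locally_disjoint_families_def)
  have HP: "h permutes {1..n}" if "h \<in> ?H" for h
    using that by (auto simp: block_perms_def elim!: permutes_subset)
  have "inj_on (\<lambda>(\<sigma>, h). \<sigma> \<circ> h) (S \<times> ?H)"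
  proof (rule inj_onI, clarify)
    fix \<sigma> h \<tau> g
    assume \<sigma>: "\<sigma> \<in> S" and \<tau>: "\<tau> \<in> S" and h: "h \<in> ?H" and g: "g \<in> ?H"
      and eq: "\<sigma> \<circ> h = \<tau> \<circ> g"
    have bij: "bij \<sigma>" "bij \<tau>" "bij h" "bij g"
      using \<sigma> \<tau> h g SP HP permutes_bij by blast+
    have "(inv \<sigma> a + 2) div 3 = (inv \<tau> a + 2) div 3" for a
    proof -
      \<comment> \<open>The position of \<open>a\<close> in the common product; \<open>h\<close> and
        \<open>g\<close> send it to the positions of \<open>a\<close> in \<open>\<sigma>\<close> and
        \<open>\<tau>\<close> without leaving its block.\<close>
      define i where "i = inv (\<sigma> \<circ> h) a"
      have "\<sigma> (h i) = a" "\<tau> (g i) = a"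
        using bij eq by (metis i_def bij_comp bij_is_surj comp_apply surj_f_inv_f)+
      then have "inv \<sigma> a = h i" "inv \<tau> a = g i"
        using bij by (metis bij_is_inj inv_f_f)+
      then show ?thesis using h g by (simp add: block_perms_def)
    qed
    then have "\<sigma> = \<tau>"
      using S \<sigma> \<tau> not_locally_disjoint_same_blocks[of \<sigma> \<tau> n]
      by (auto simp: locally_disjoint_families_def pairwise_def)
    moreover from this have "h = g"
      using eq bij(2) by (metis bij_is_inj fun.inj_map injD)
    ultimately show "\<sigma> = \<tau> \<and> h = g" by simp
  qed
  moreover have "(\<lambda>(\<sigma>, h). \<sigma> \<circ> h) ` (S \<times> ?H) \<subseteq> ?P"
    using SP HP by (auto intro: permutes_compose)
  ultimately have "card (S \<times> ?H) \<le> card ?P"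
    by (rule card_inj_on_le) (simp add: finite_permutations)
  also have "card ?P = fact n"
    by (rule card_permutations) simp_all
  finally have "card S * card ?H \<le> fact n"
    by (simp add: card_cartesian_product)
  then show ?thesis
    using card_block_perms_ge[of "n div 3"] by (meson le_trans mult_le_mono2)
qed

theorem theorem1:
  fixes n :: nat
  assumes "n \<ge> 1"
  shows "fact n / 5 ^ n \<le> real (max_locally_disjoint n)
       \<and> real (max_locally_disjoint n) \<le> fact n / 6 ^ (n div 3)"
proof
  have "real (fact n) \<le> real (max_locally_disjoint n * 5 ^ n)"
    using fact_le_max_locally_disjoint by (simp only: of_nat_le_iff)
  then show "fact n / 5 ^ n \<le> real (max_locally_disjoint n)"
    by (simp add: pos_divide_le_eq)
next
  have "max_locally_disjoint n \<in> card ` locally_disjoint_families n"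
    unfolding max_locally_disjoint_def
    by (rule Max_in) (simp_all add: finite_locally_disjoint_families locally_disjoint_families_nonempty)
  then have "max_locally_disjoint n * 6 ^ (n div 3) \<le> fact n"
    using card_locally_disjoint_family_le by auto
  then have "real (max_locally_disjoint n * 6 ^ (n div 3)) \<le> real (fact n)"
    by (simp only: of_nat_le_iff)
  then show "real (max_locally_disjoint n) \<le> fact n / 6 ^ (n div 3)"
    by (simp add: pos_le_divide_eq)
qed

end
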